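(* Let $m, n$ be positive integers. Let $\mathcal{P}$ be the set of Dyck paths having no ascending run of length in $\{1,\dots,m\}$ and no descending run of length in $\{1,\dots,n\}$. Then $\mathcal{P}$ satisfies the following grammatical equations, where $\epsilon$ is the empty path: if $m \geq n$, then $$\mathcal{P} \cup UD\mathcal{P} = \{\epsilon\} \cup U\mathcal{P}D\mathcal{P} \cup U^{m+1}D^{n+1}(\mathcal{P}D)^{m-n}\mathcal{P},$$ and if $m \leq n$, then $$\mathcal{P} \cup UD\mathcal{P} = \{\epsilon\} \cup U\mathcal{P}D\mathcal{P} \cup (U\mathcal{P})^{n-m}U^{m+1}D^{n+1}\mathcal{P}.$$
   Context: A Dyck path is a finite (possibly empty) word in the letters $U$ (standing for $+1$) and $D$ (standing for $-1$) whose partial sums are all nonnegative and whose total sum is $0$. An ascending run (up-run) of length $\ell$ is a block of $\ell$ consecutive $U$'s that is neither preceded nor followed by a $U$; a descending run (down-run) of length $\ell$ is a block of $\ell$ consecutive $D$'s that is neither preceded nor followed by a $D$. A grammatical equation is an equality of sets of words over $\{U,D\}$, combined by concatenation: for languages $L, L'$, $LL'$ is the set of words $ww'$ with $w\in L$, $w'\in L'$; $L^k$ is the $k$-fold concatenation, $L^0=\{\epsilon\}$; $U$ and $D$ denote the one-letter languages. *)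

theory Defs
  imports Main
begin

datatype step = U | D

primrec step_val :: "step \<Rightarrow> int" where
  "step_val U = 1"
| "step_val D = -1"

definition dyck_path :: "step list \<Rightarrow> bool" where
  "dyck_path w \<longleftrightarrow>
     (\<forall>k \<le> length w. 0 \<le> sum_list (map step_val (take k w))) \<and>
     sum_list (map step_val w) = 0"

definition has_run :: "step \<Rightarrow> nat \<Rightarrow> step list \<Rightarrow> bool" where
  "has_run s l w \<longleftrightarrow> 0 < l \<and>
     (\<exists>xs ys. w = xs @ replicate l s @ ys \<and>
        (xs = [] \<or> last xs \<noteq> s) \<and> (ys = [] \<or> hd ys \<noteq> s))"

definition avoiding_paths :: "nat \<Rightarrow> nat \<Rightarrow> step list set" where
  "avoiding_paths m n =
     {w. dyck_path w \<and> (\<forall>l\<in>{1..m}. \<not> has_run U l w) \<and> (\<forall>l\<in>{1..n}. \<not> has_run D l w)}"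

definition conc :: "'a list set \<Rightarrow> 'a list set \<Rightarrow> 'a list set" (infixr "@@" 75) where
  "L @@ L' = {w @ w' | w w'. w \<in> L \<and> w' \<in> L'}"

primrec lang_pow :: "'a list set \<Rightarrow> nat \<Rightarrow> 'a list set" where
  "lang_pow L 0 = {[]}"
| "lang_pow L (Suc k) = L @@ lang_pow L k"

end

theory Submission
  imports Defs
begin

text \<open>Split a nonempty path at its first return to the axis into a prime path \<open>U A D\<close> and a
  remainder in \<open>P\<close>. Suppose \<open>n \<le> m\<close>. If the first up-run of \<open>U A D\<close> is longer than \<open>m + 1\<close>,
  then \<open>A\<close> is in \<open>P\<close>. Otherwise \<open>U A D\<close> starts with the word \<open>U\<^sup>m\<^sup>+\<^sup>1 D\<^sup>n\<^sup>+\<^sup>1\<close>, and cutting the rest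
  where it first reaches each height below \<open>m - n\<close> writes it as an element of \<open>(P D)\<^sup>m\<^sup>-\<^sup>n\<close>. The
  case \<open>m \<le> n\<close> follows by reversing the prime paths and exchanging \<open>U\<close> and \<open>D\<close>.\<close>

section \<open>Runs\<close>

text \<open>Stated for one letter, so that up-runs and down-runs share the same lemmas and reversal
  merely exchanges the two instances.\<close>

definition long_runs :: "step \<Rightarrow> nat \<Rightarrow> step list \<Rightarrow> bool" where
  "long_runs s k w \<longleftrightarrow> (\<forall>l\<in>{1..k}. \<not> has_run s l w)"

lemma has_run_replicate:
  assumes "0 < l" "xs = [] \<or> last xs \<noteq> s" "ys = [] \<or> hd ys \<noteq> s"
  shows "has_run s l (xs @ replicate l s @ ys)"
  using assms unfolding has_run_def by blast

lemma replicate_prefix_le: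
  assumes "replicate l s @ ys = replicate k s @ zs" "ys = [] \<or> hd ys \<noteq> s"
  shows "k \<le> l"
proof (rule ccontr)
  assume "\<not> k \<le> l"
  then have "replicate k s = replicate l s @ replicate (k - l) s" "k - l > 0"
    by (simp_all flip: replicate_add)
  then show False
    using assms by (cases "k - l") auto
qed

lemma split_replicate:
  obtains j ys where "w = replicate j s @ ys" "ys = [] \<or> hd ys \<noteq> s"
proof -
  have "takeWhile ((=) s) w = replicate (length (takeWhile ((=) s) w)) s"
    by (rule replicate_eqI) (auto dest: set_takeWhileD)
  moreover have "dropWhile ((=) s) w = [] \<or> hd (dropWhile ((=) s) w) \<noteq> s"
    using hd_dropWhile[of "(=) s" w] by fastforce
  ultimately show ?thesis
    using that by (metis takeWhile_dropWhile_id)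
qed

text \<open>Runs are located by their first letter: where a run of \<open>s\<close> starts,
  \<open>k\<close> further copies must follow, so its length is at least \<open>k + 1\<close>. This
  form does not ask where the run ends and is therefore easy to use on concatenations.\<close>

lemma long_runs_iff:
  "long_runs s k w \<longleftrightarrow>
    (\<forall>xs ys. w = xs @ s # ys \<longrightarrow> xs = [] \<or> last xs \<noteq> s \<longrightarrow> (\<exists>zs. ys = replicate k s @ zs))"
    (is "_ \<longleftrightarrow> ?R")
proof
  assume long: "long_runs s k w"
  show ?R
  proof (intro allI impI)
    fix xs ys
    assume w: "w = xs @ s # ys" and xs: "xs = [] \<or> last xs \<noteq> s"
    obtain j zs where j: "ys = replicate j s @ zs" "zs = [] \<or> hd zs \<noteq> s"
      by (rule split_replicate)
    have "has_run s (Suc j) w"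
      using has_run_replicate[of "Suc j" xs s zs] w xs j by simp
    then have "k \<le> j"
      using long unfolding long_runs_def by fastforce
    then show "\<exists>zs. ys = replicate k s @ zs"
      using j by (metis append.assoc le_add_diff_inverse replicate_add)
  qed
next
  assume R: ?R
  show "long_runs s k w"
    unfolding long_runs_def
  proof (intro ballI notI)
    fix l assume l: "l \<in> {1..k}" and "has_run s l w"
    then obtain xs ys where w: "w = xs @ replicate l s @ ys"
      and xs: "xs = [] \<or> last xs \<noteq> s" and ys: "ys = [] \<or> hd ys \<noteq> s"
      unfolding has_run_def by blast
    obtain l' where l': "l = Suc l'" using l by (cases l) auto
    then obtain zs where "replicate l' s @ ys = replicate k s @ zs"
      using R w xs by force
    then have "k \<le> l'"
      using ys by (rule replicate_prefix_le)
    then show False using l l' by simp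
  qed
qed

lemma long_runs_Nil [simp]: "long_runs s k []"
  by (simp add: long_runs_iff)

lemma long_runs_replicate_other:
  "s \<noteq> t \<Longrightarrow> long_runs s k (replicate j t)"
  unfolding long_runs_iff
  by (metis in_set_conv_decomp in_set_replicate)

lemma long_runs_single_other: "s \<noteq> t \<Longrightarrow> long_runs s k [t]"
  using long_runs_replicate_other[of s t k 1] by simp

lemma long_runs_replicate:
  assumes "k < j" shows "long_runs s k (replicate j s)"
  unfolding long_runs_iff
proof (intro allI impI)
  fix xs ys
  assume eq: "replicate j s = xs @ s # ys" and "xs = [] \<or> last xs \<noteq> s"
  then have "xs = []"
    by (metis in_set_replicate last_in_set UnCI set_append)
  then have "ys = replicate (j - 1) s"
    using eq by (cases j) auto
  moreover have "j - 1 = k + (j - 1 - k)" using assms by simp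
  ultimately show "\<exists>zs. ys = replicate k s @ zs"
    by (metis replicate_add)
qed

lemma long_runs_replicateD:
  assumes "long_runs s k (xs @ replicate j s @ ys)" "0 < j"
    "xs = [] \<or> last xs \<noteq> s" "ys = [] \<or> hd ys \<noteq> s"
  shows "k < j"
proof (rule ccontr)
  assume "\<not> k < j"
  then have "j \<in> {1..k}" using assms by simp
  then show False
    using assms has_run_replicate[of j xs s ys] unfolding long_runs_def by blast
qed

text \<open>A run of the concatenation starts inside \<open>xs\<close> or inside \<open>ys\<close>,
  where it also starts a run of that factor; gluing can only lengthen it.\<close>

lemma long_runs_append:
  assumes "long_runs s k xs" "long_runs s k ys"
  shows "long_runs s k (xs @ ys)"
  unfolding long_runs_iff
proof (intro allI impI)
  fix as bs
  assume eq: "xs @ ys = as @ s # bs" and as: "as = [] \<or> last as \<noteq> s"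
  from eq consider cs where "xs = as @ s # cs" "bs = cs @ ys"
    | us where "as = xs @ us" "ys = us @ s # bs"
    by (auto simp: append_eq_append_conv2 append_eq_Cons_conv Cons_eq_append_conv)
  then show "\<exists>zs. bs = replicate k s @ zs"
  proof cases
    case 1
    then show ?thesis using assms(1) as unfolding long_runs_iff by fastforce
  next
    case 2
    then have "us = [] \<or> last us \<noteq> s" using as by auto
    then show ?thesis using assms(2) 2 unfolding long_runs_iff by blast
  qed
qed

text \<open>Converse of \<open>long_runs_append\<close>, valid as long as the cut does not pass
  through a run of \<open>s\<close>.\<close>

lemma long_runs_split:
  assumes long: "long_runs s k (xs @ ys)"
    and boundary: "xs = [] \<or> ys = [] \<or> last xs \<noteq> s \<or> hd ys \<noteq> s"
  shows "long_runs s k xs" "long_runs s k ys"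
proof -
  show "long_runs s k ys"
    unfolding long_runs_iff
  proof (intro allI impI)
    fix us bs
    assume "ys = us @ s # bs" "us = [] \<or> last us \<noteq> s"
    then have "xs @ ys = (xs @ us) @ s # bs" "xs @ us = [] \<or> last (xs @ us) \<noteq> s"
      using boundary by (cases "us = []"; auto)+
    then show "\<exists>zs. bs = replicate k s @ zs"
      using long unfolding long_runs_iff by blast
  qed
  show "long_runs s k xs"
    unfolding long_runs_iff
  proof (intro allI impI)
    fix as cs
    assume xs: "xs = as @ s # cs" and as: "as = [] \<or> last as \<noteq> s"
    obtain j us where j: "cs = replicate j s @ us" "us = [] \<or> hd us \<noteq> s"
      by (rule split_replicate)
    \<comment> \<open>The run under consideration ends inside \<open>xs\<close>: if it reaches the
      end of \<open>xs\<close>, the boundary condition keeps \<open>ys\<close> from prolonging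
      it.\<close>
    have "us @ ys = [] \<or> hd (us @ ys) \<noteq> s"
    proof (cases "us = []")
      case True
      then have "last xs = s" using xs j by (simp add: last_replicate)
      then show ?thesis using boundary xs True by auto
    qed (use j in auto)
    moreover obtain zs where "cs @ ys = replicate k s @ zs"
      using long xs as unfolding long_runs_iff by force
    ultimately have "k \<le> j"
      using j replicate_prefix_le[of j s "us @ ys" k zs] by simp
    then show "\<exists>zs. cs = replicate k s @ zs"
      using j by (metis append.assoc le_add_diff_inverse replicate_add)
  qed
qed

text \<open>The new letter prolongs the last run, so no new run starts.\<close>

lemma long_runs_snoc:
  assumes "long_runs s k xs" "xs \<noteq> []" "last xs = s"
  shows "long_runs s k (xs @ [s])"
  unfolding long_runs_iff
proof (intro allI impI)
  fix as bs
  assume eq: "xs @ [s] = as @ s # bs" and as: "as = [] \<or> last as \<noteq> s"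
  show "\<exists>zs. bs = replicate k s @ zs"
  proof (cases bs rule: rev_cases)
    case Nil
    then show ?thesis using eq as assms by simp
  next
    case (snoc cs c)
    then have "xs = as @ s # cs" using eq by simp
    then show ?thesis using assms(1) as snoc unfolding long_runs_iff by fastforce
  qed
qed

section \<open>Reversal\<close>

primrec flip :: "step \<Rightarrow> step" where
  "flip U = D"
| "flip D = U"

text \<open>Reflection of the path in a vertical line. It preserves Dyck paths and exchanges up-runs
  with down-runs, hence the roles of \<open>m\<close> and \<open>n\<close>.\<close>

definition mirror :: "step list \<Rightarrow> step list" where
  "mirror w = rev (map flip w)"

lemma flip_flip [simp]: "flip (flip s) = s"
  by (cases s) auto

lemma mirror_append [simp]: "mirror (xs @ ys) = mirror ys @ mirror xs"
  by (simp add: mirror_def)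

lemma mirror_Nil [simp]: "mirror [] = []"
  by (simp add: mirror_def)

lemma mirror_Cons [simp]: "mirror (s # w) = mirror w @ [flip s]"
  by (simp add: mirror_def)

lemma mirror_mirror [simp]: "mirror (mirror w) = w"
  by (simp add: mirror_def rev_map o_def)

lemma mirror_replicate [simp]: "mirror (replicate l s) = replicate l (flip s)"
  by (simp add: mirror_def)

lemma mirror_eq_Nil [simp]: "mirror w = [] \<longleftrightarrow> w = []"
  by (simp add: mirror_def)

lemma last_mirror: "w \<noteq> [] \<Longrightarrow> last (mirror w) = flip (hd w)"
  by (simp add: mirror_def last_rev hd_map)

lemma hd_mirror: "w \<noteq> [] \<Longrightarrow> hd (mirror w) = flip (last w)"
  by (simp add: mirror_def hd_rev last_map)

lemma has_run_mirrorI: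
  assumes "has_run s l w" shows "has_run (flip s) l (mirror w)"
proof -
  obtain xs ys where w: "w = xs @ replicate l s @ ys" "0 < l"
    and xs: "xs = [] \<or> last xs \<noteq> s" and ys: "ys = [] \<or> hd ys \<noteq> s"
    using assms unfolding has_run_def by blast
  have "mirror ys = [] \<or> last (mirror ys) \<noteq> flip s"
    using ys last_mirror by (metis flip_flip mirror_Nil)
  moreover have "mirror xs = [] \<or> hd (mirror xs) \<noteq> flip s"
    using xs hd_mirror by (metis flip_flip mirror_Nil)
  ultimately show ?thesis
    using has_run_replicate[of l "mirror ys" "flip s" "mirror xs"] w by simp
qed

lemma has_run_mirror: "has_run s l (mirror w) \<longleftrightarrow> has_run (flip s) l w"
  using has_run_mirrorI[of s l "mirror w"] has_run_mirrorI[of "flip s" l w] by auto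

lemma long_runs_mirror: "long_runs s k (mirror w) \<longleftrightarrow> long_runs (flip s) k w"
  by (simp add: long_runs_def has_run_mirror)

text \<open>Reversal of \<open>long_runs_snoc\<close>.\<close>

lemma long_runs_Cons:
  assumes "long_runs s k xs" "xs \<noteq> []" "hd xs = s"
  shows "long_runs s k (s # xs)"
proof -
  have "long_runs (flip s) k (mirror xs @ [flip s])"
    using assms by (intro long_runs_snoc) (simp_all add: long_runs_mirror last_mirror)
  then show ?thesis
    using long_runs_mirror[of "flip s" k "s # xs"] by simp
qed

section \<open>Heights\<close>

definition height :: "step list \<Rightarrow> int" where
  "height w = sum_list (map step_val w)"

lemma height_simps [simp]:
  "height [] = 0" "height (s # w) = step_val s + height w"
  "height (xs @ ys) = height xs + height ys"
  by (simp_all add: height_def)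

lemma height_replicate [simp]: "height (replicate j s) = int j * step_val s"
  by (simp add: height_def sum_list_replicate)

text \<open>The recursion avoids quantifying over prefixes, and the starting height \<open>c\<close>
  lets it speak of pieces cut out of a path.\<close>

primrec nonneg_from :: "step list \<Rightarrow> int \<Rightarrow> bool" where
  "nonneg_from [] c \<longleftrightarrow> 0 \<le> c"
| "nonneg_from (s # w) c \<longleftrightarrow> 0 \<le> c \<and> nonneg_from w (c + step_val s)"

lemma all_le_Suc: "(\<forall>k \<le> Suc n. Q k) \<longleftrightarrow> Q 0 \<and> (\<forall>k \<le> n. Q (Suc k))"
  by (metis Suc_le_mono le0 not0_implies_Suc)

lemma nonneg_from_iff:
  "nonneg_from w c \<longleftrightarrow> (\<forall>k \<le> length w. 0 \<le> c + height (take k w))"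
proof (induction w arbitrary: c)
  case (Cons s w)
  have "(\<forall>k \<le> Suc (length w). 0 \<le> c + height (take k (s # w))) \<longleftrightarrow>
    0 \<le> c \<and> (\<forall>k \<le> length w. 0 \<le> c + height (take (Suc k) (s # w)))"
    by (simp only: all_le_Suc) simp
  then show ?case using Cons by (simp add: add.assoc)
qed simp

lemma dyck_path_iff: "dyck_path w \<longleftrightarrow> nonneg_from w 0 \<and> height w = 0"
  by (simp add: dyck_path_def nonneg_from_iff height_def)

lemma nonneg_from_start: "nonneg_from w c \<Longrightarrow> 0 \<le> c"
  by (cases w) auto

lemma nonneg_from_append [simp]:
  "nonneg_from (xs @ ys) c \<longleftrightarrow> nonneg_from xs c \<and> nonneg_from ys (c + height xs)"
  by (induction xs arbitrary: c) (auto simp: add.assoc dest: nonneg_from_start)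

lemma nonneg_from_mono: "nonneg_from w c \<Longrightarrow> c \<le> c' \<Longrightarrow> nonneg_from w c'"
  by (induction w arbitrary: c c') fastforce+

lemma nonneg_from_replicate_U: "0 \<le> c \<Longrightarrow> nonneg_from (replicate j U) c"
  by (induction j arbitrary: c) auto

lemma nonneg_from_replicate_D: "int j \<le> c \<Longrightarrow> nonneg_from (replicate j D) c"
  by (induction j arbitrary: c) auto

lemma step_val_flip [simp]: "step_val (flip s) = - step_val s"
  by (cases s) auto

lemma height_mirror [simp]: "height (mirror w) = - height w"
  by (induction w) auto

text \<open>The reflected path visits the same heights in the opposite order, starting where
  \<open>w\<close> ends.\<close>

lemma nonneg_from_mirror: "nonneg_from (mirror w) (c + height w) \<longleftrightarrow> nonneg_from w c"
proof (induction w arbitrary: c)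
  case (Cons s w)
  show ?case
    using Cons[of "c + step_val s"] by (auto simp: algebra_simps dest: nonneg_from_start)
qed simp

text \<open>Heights change by one at each step, so a path ending below 0 first becomes negative
  through a \<open>D\<close> taken at height 0; the cut is made there.\<close>

lemma first_descent:
  assumes "0 \<le> c" "c + height w < 0"
  shows "\<exists>xs ys. w = xs @ D # ys \<and> nonneg_from xs c \<and> c + height xs = 0"
  using assms
proof (induction w arbitrary: c)
  case (Cons s w)
  show ?case
  proof (cases "s = D \<and> c = 0")
    case True
    then show ?thesis by (intro exI[of _ "[]"] exI[of _ w]) simp
  next
    case False
    then have "0 \<le> c + step_val s" using Cons.prems by (cases s) auto
    then obtain xs ys where "w = xs @ D # ys" "nonneg_from xs (c + step_val s)"
      "c + step_val s + height xs = 0"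
      using Cons.IH[of "c + step_val s"] Cons.prems by auto
    then show ?thesis
      using Cons.prems by (intro exI[of _ "s # xs"] exI[of _ ys]) simp
  qed
qed simp

lemma dyck_path_append: "dyck_path xs \<Longrightarrow> dyck_path ys \<Longrightarrow> dyck_path (xs @ ys)"
  by (simp add: dyck_path_iff)

lemma dyck_path_elevate: "dyck_path w \<Longrightarrow> dyck_path (U # w @ [D])"
  by (auto simp: dyck_path_iff intro: nonneg_from_mono)

text \<open>Without its initial \<open>U\<close> the path ends at -1, and its first passage below 0
  is the first return of \<open>w\<close> to the axis.\<close>

lemma first_return:
  assumes "dyck_path w" "w \<noteq> []"
  obtains xs ys where "w = U # xs @ D # ys" "dyck_path xs" "dyck_path ys"
proof -
  obtain w' where w: "w = U # w'"
    using assms by (cases w; cases "hd w") (auto simp: dyck_path_iff dest: nonneg_from_start)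
  then have "height w' < 0" using assms by (simp add: dyck_path_iff)
  then obtain xs ys where "w' = xs @ D # ys" "nonneg_from xs 0" "height xs = 0"
    using first_descent[of 0 w'] by auto
  then show ?thesis
    using that[of xs ys] assms w by (simp add: dyck_path_iff)
qed

lemma hd_dyck_path: "dyck_path w \<Longrightarrow> w \<noteq> [] \<Longrightarrow> hd w = U"
  by (erule (1) first_return) simp

lemma dyck_path_mirror: "dyck_path (mirror w) \<longleftrightarrow> dyck_path w"
  using nonneg_from_mirror[of w 0] by (auto simp: dyck_path_iff)

lemma last_dyck_path: "dyck_path w \<Longrightarrow> w \<noteq> [] \<Longrightarrow> last w = D"
  using hd_dyck_path[of "mirror w"] hd_mirror[of w]
  by (simp add: dyck_path_mirror) (metis flip.simps(1) flip_flip)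

section \<open>Avoiding paths\<close>

lemma avoiding_paths_iff:
  "w \<in> avoiding_paths m n \<longleftrightarrow> dyck_path w \<and> long_runs U m w \<and> long_runs D n w"
  by (simp add: avoiding_paths_def long_runs_def)

lemma avoiding_paths_Nil: "[] \<in> avoiding_paths m n"
  by (simp add: avoiding_paths_iff dyck_path_iff)

lemma avoiding_paths_append:
  "v \<in> avoiding_paths m n \<Longrightarrow> w \<in> avoiding_paths m n \<Longrightarrow> v @ w \<in> avoiding_paths m n"
  by (simp add: avoiding_paths_iff dyck_path_append long_runs_append)

lemma avoiding_paths_mirror: "mirror w \<in> avoiding_paths m n \<longleftrightarrow> w \<in> avoiding_paths n m"
  by (auto simp: avoiding_paths_iff dyck_path_mirror long_runs_mirror)

text \<open>The outer \<open>U\<close> joins the first up-run and the outer \<open>D\<close> joins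
  the last down-run. For empty \<open>w\<close> they would instead form new runs of length
  1.\<close>

lemma avoiding_paths_elevate:
  assumes "w \<in> avoiding_paths m n" "w \<noteq> []"
  shows "U # w @ [D] \<in> avoiding_paths m n"
proof -
  have w: "dyck_path w" "long_runs U m w" "long_runs D n w"
    using assms by (auto simp: avoiding_paths_iff)
  have "long_runs U m ((U # w) @ [D])"
    using w assms hd_dyck_path by (intro long_runs_append long_runs_Cons long_runs_single_other) auto
  moreover have "long_runs D n ([U] @ (w @ [D]))"
    using w assms last_dyck_path by (intro long_runs_append long_runs_snoc long_runs_single_other) auto
  ultimately show ?thesis
    using w by (simp add: avoiding_paths_iff dyck_path_elevate)
qed

lemma split_replicate_right:
  obtains j xs where "w = xs @ replicate j s" "xs = [] \<or> last xs \<noteq> s"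
proof -
  obtain j ys where "rev w = replicate j s @ ys" "ys = [] \<or> hd ys \<noteq> s"
    by (rule split_replicate)
  then show ?thesis
    using that[of "rev ys" j] by (auto simp: rev_swap last_rev)
qed

lemma step_neq: "s \<noteq> U \<longleftrightarrow> s = D"
  by (cases s) simp_all

text \<open>The last down-run of a Dyck path is at least as long as the last up-run, hence long.\<close>

lemma long_down_runs_factor:
  assumes A: "dyck_path A" "long_runs U m A" and XY: "long_runs D n (X @ A @ Y)" and "n \<le> m"
  shows "long_runs D n A"
proof (cases "A = []")
  case False
  obtain l B where B: "A = B @ replicate l D" "B = [] \<or> last B \<noteq> D"
    by (rule split_replicate_right)
  obtain i E where E: "B = E @ replicate i U" "E = [] \<or> last E \<noteq> U"
    by (rule split_replicate_right)
  have hd: "hd A = U" and last: "last A = D"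
    using A False hd_dyck_path last_dyck_path by auto
  have "l > 0" using last B False by (cases l) auto
  have "B \<noteq> []" using hd B \<open>l > 0\<close> by (cases l) auto
  have "i > 0" using B E \<open>B \<noteq> []\<close> by (cases i) (auto simp: step_neq)
  have "m < i"
    using long_runs_replicateD[of U m E i "replicate l D"] A B E \<open>i > 0\<close> \<open>l > 0\<close>
    by (cases l) auto
  \<comment> \<open>\<open>A\<close> is \<open>E\<close> followed by \<open>i\<close> up-steps and
    \<open>l\<close> down-steps back to 0, and \<open>E\<close> ends at a nonnegative height; hence
    \<open>l\<close> is at least \<open>i\<close>.\<close>
  moreover have "0 \<le> height E" "height E + int i = int l"
    using A B E by (auto simp: dyck_path_iff dest: nonneg_from_start)
  ultimately have "n < l" using \<open>n \<le> m\<close> by simp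
  \<comment> \<open>The last down-run of \<open>A\<close> may continue into \<open>Y\<close>, which
    is why the heights were needed for it. All other down-runs of \<open>A\<close> are complete runs
    of the surrounding word.\<close>
  have "long_runs D n (A @ Y)"
    using long_runs_split(2)[OF XY] hd False by simp
  then have "long_runs D n B"
    using long_runs_split(1)[of D n B "replicate l D @ Y"] B \<open>B \<noteq> []\<close> by simp
  then show ?thesis
    using B \<open>n < l\<close> by (simp add: long_runs_append long_runs_replicate)
qed simp

section \<open>Languages\<close>

lemma concI: "v \<in> L \<Longrightarrow> w \<in> L' \<Longrightarrow> v @ w \<in> L @@ L'"
  by (auto simp: conc_def)

lemma concE:
  assumes "u \<in> L @@ L'" obtains v w where "u = v @ w" "v \<in> L" "w \<in> L'"
  using assms by (auto simp: conc_def)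

lemma conc_assoc: "(L @@ L') @@ L'' = L @@ L' @@ L''"
  unfolding conc_def by (auto, metis append.assoc, metis append.assoc)

lemma conc_Un_left: "(L \<union> L') @@ L'' = L @@ L'' \<union> L' @@ L''"
  by (auto simp: conc_def)

lemma conc_Nil [simp]: "L @@ {[]} = L" "{[]} @@ L = L"
  by (auto simp: conc_def)

lemma lang_pow_single: "lang_pow {[s]} k = {replicate k s}"
  by (induction k) (auto simp: conc_def)

lemma lang_pow_commute: "lang_pow L k @@ L = L @@ lang_pow L k"
  by (induction k) (auto simp: conc_assoc)

lemma mirror_conc: "mirror ` (L @@ L') = mirror ` L' @@ mirror ` L"
  unfolding conc_def by (auto simp: image_iff) (metis mirror_append)+

text \<open>Reversal reverses the order of the factors, which is harmless since a power commutes
  with its base.\<close>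

lemma mirror_lang_pow: "mirror ` lang_pow L k = lang_pow (mirror ` L) k"
  by (induction k) (simp_all add: mirror_conc lang_pow_commute)

lemma mirror_image_avoiding_paths: "mirror ` avoiding_paths m n = avoiding_paths n m"
  by (auto simp: avoiding_paths_mirror image_iff) (metis avoiding_paths_mirror mirror_mirror)

section \<open>Prime paths\<close>

text \<open>Cutting at the first passage below each height leaves \<open>d + 1\<close> Dyck pieces;
  the appended \<open>D\<close> closes the last one. As \<open>G\<close> may begin or end within a
  down-run, the condition on down-runs is imposed on a surrounding word.\<close>

lemma descent_decomposition:
  assumes "nonneg_from G (int d)" "int d + height G = 0" "long_runs U m G"
    "long_runs D n (X @ G @ Y)" "n \<le> m"
  shows "G @ [D] \<in> lang_pow (avoiding_paths m n @@ {[D]}) (Suc d)"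
  using assms
proof (induction d arbitrary: G X)
  case 0
  then have "dyck_path G" by (simp add: dyck_path_iff)
  then have "G \<in> avoiding_paths m n"
    using 0 long_down_runs_factor by (auto simp: avoiding_paths_iff)
  then show ?case by (auto intro: concI)
next
  case (Suc d)
  \<comment> \<open>Heights are taken relative to the start of \<open>G\<close>, so the cut is at
    the first step below the starting level and \<open>A\<close> is a Dyck path.\<close>
  then obtain A G' where G: "G = A @ D # G'" and A: "dyck_path A"
    using first_descent[of 0 G] by (auto simp: dyck_path_iff)
  have "long_runs U m A" "long_runs U m (D # G')"
    using Suc.prems(3) long_runs_split[of U m A "D # G'"] unfolding G by simp_all
  then have "A \<in> avoiding_paths m n"
    using A Suc.prems long_down_runs_factor[of A m n X "D # G' @ Y"]
    by (simp add: G avoiding_paths_iff)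
  moreover have "long_runs U m G'"
    using \<open>long_runs U m (D # G')\<close> long_runs_split(2)[of U m "[D]" G'] by simp
  \<comment> \<open>The part already cut off is moved into the left context, so the surrounding word
    stays the same.\<close>
  then have "G' @ [D] \<in> lang_pow (avoiding_paths m n @@ {[D]}) (Suc d)"
    using Suc.prems A by (intro Suc.IH[of _ "X @ A @ [D]"]) (auto simp: G dyck_path_iff)
  ultimately have "(A @ [D]) @ (G' @ [D]) \<in> lang_pow (avoiding_paths m n @@ {[D]}) (Suc (Suc d))"
    unfolding lang_pow.simps(2)[of _ "Suc d"] by (blast intro: concI)
  then show ?case by (simp add: G)
qed

text \<open>Each factor brings its own long runs, and its \<open>D\<close> prolongs a down-run
  already present; \<open>X\<close> ending in \<open>D\<close> is the invariant that ensures
  this.\<close>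

lemma avoiding_paths_descent:
  assumes "G \<in> lang_pow (avoiding_paths m n @@ {[D]}) d"
    "nonneg_from X 0" "height X = int d" "long_runs U m X" "long_runs D n X"
    "X \<noteq> []" "last X = D"
  shows "X @ G \<in> avoiding_paths m n"
  using assms
proof (induction d arbitrary: G X)
  case 0
  then show ?case by (simp add: avoiding_paths_iff dyck_path_iff)
next
  case (Suc d)
  then obtain A G' where G: "G = A @ D # G'" and A: "A \<in> avoiding_paths m n"
    and G': "G' \<in> lang_pow (avoiding_paths m n @@ {[D]}) d"
    by (auto elim!: concE)
  have A': "dyck_path A" "long_runs U m A" "long_runs D n A"
    using A by (auto simp: avoiding_paths_iff)
  \<comment> \<open>For empty \<open>A\<close> the next \<open>D\<close> attaches to the last
    down-run of \<open>X\<close>, otherwise to that of \<open>A\<close>.\<close>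
  have "last (X @ A) = D" using Suc.prems A' last_dyck_path by (cases "A = []") auto
  then have "long_runs D n ((X @ A) @ [D])"
    using Suc.prems A' by (intro long_runs_snoc long_runs_append) auto
  moreover have "long_runs U m ((X @ A) @ [D])"
    using Suc.prems A' by (intro long_runs_append long_runs_single_other) auto
  moreover have "nonneg_from A (1 + int d)"
    using A' by (auto simp: dyck_path_iff intro: nonneg_from_mono)
  ultimately have "(X @ A @ [D]) @ G' \<in> avoiding_paths m n"
    using Suc.prems A' G' by (intro Suc.IH) (auto simp: dyck_path_iff)
  then show ?case by (simp add: G)
qed

text \<open>The two terms of the equation for \<open>m \<ge> n\<close> with their common last factor
  removed. The word \<open>UD\<close> is included, as the elevation of the empty path.\<close>

definition prime_lang :: "nat \<Rightarrow> nat \<Rightarrow> step list set" where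
  "prime_lang m n = {[U]} @@ avoiding_paths m n @@ {[D]} \<union>
     lang_pow {[U]} (m + 1) @@ lang_pow {[D]} (n + 1) @@
       lang_pow (avoiding_paths m n @@ {[D]}) (m - n)"

lemma elevate_in_prime_lang:
  "w \<in> avoiding_paths m n \<Longrightarrow> U # w @ [D] \<in> prime_lang m n"
  unfolding prime_lang_def using concI[of "[U]" "{[U]}" "w @ [D]"] by (auto intro: concI)

lemma prime_lang_subset:
  assumes "n \<le> m"
  shows "prime_lang m n \<subseteq> insert [U, D] (avoiding_paths m n)"
proof
  fix w assume "w \<in> prime_lang m n"
  then consider A where "A \<in> avoiding_paths m n" "w = U # A @ [D]"
    | G where "G \<in> lang_pow (avoiding_paths m n @@ {[D]}) (m - n)"
        "w = (replicate (m + 1) U @ replicate (n + 1) D) @ G"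
    unfolding prime_lang_def lang_pow_single by (auto elim!: concE)
  then show "w \<in> insert [U, D] (avoiding_paths m n)"
  proof cases
    case 1
    then show ?thesis using avoiding_paths_elevate by (cases "A = []") auto
  next
    case 2
    have "w \<in> avoiding_paths m n"
      unfolding 2(2)
    \<comment> \<open>The prefix ends in \<open>D\<close> at height
      \<open>(m + 1) - (n + 1)\<close>, exactly the number of remaining factors.\<close>
    proof (rule avoiding_paths_descent[OF 2(1)])
      show "nonneg_from (replicate (m + 1) U @ replicate (n + 1) D) 0"
        unfolding nonneg_from_append using assms
        by (intro conjI nonneg_from_replicate_U nonneg_from_replicate_D) auto
      show "long_runs U m (replicate (m + 1) U @ replicate (n + 1) D)"
        by (intro long_runs_append long_runs_replicate long_runs_replicate_other) auto
      show "long_runs D n (replicate (m + 1) U @ replicate (n + 1) D)"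
        by (intro long_runs_append long_runs_replicate long_runs_replicate_other) auto
      show "last (replicate (m + 1) U @ replicate (n + 1) D) = D"
        by (simp add: last_replicate del: replicate_Suc)
    qed (use assms in auto)
    then show ?thesis by simp
  qed
qed

text \<open>Removing the outer steps shortens the first up-run by one. Its length \<open>j\<close>
  decides the term: \<open>A\<close> remains avoiding when \<open>j > m + 1\<close>, and
  \<open>j = m + 1\<close> leads to the descent.\<close>

lemma prime_in_prime_lang:
  assumes A: "dyck_path A" and w: "U # A @ [D] \<in> avoiding_paths m n" and "n \<le> m" "0 < m"
  shows "U # A @ [D] \<in> prime_lang m n"
proof -
  have long: "long_runs U m (U # A @ [D])" "long_runs D n (U # A @ [D])"
    using w by (auto simp: avoiding_paths_iff)
  \<comment> \<open>The path \<open>UD\<close> has an up-run of length 1, forbidden because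
    \<open>m\<close> is positive.\<close>
  have "A \<noteq> []"
    using long_runs_replicateD[of U m "[]" 1 "[D]"] long \<open>0 < m\<close> by auto
  then have last: "last A = D" using A last_dyck_path by simp
  obtain j C where j: "U # A = replicate j U @ C" "C = [] \<or> hd C \<noteq> U"
    by (rule split_replicate)
  have "j > 0" using j by (cases j) auto
  have "C \<noteq> []"
  proof
    assume "C = []"
    then have "last (U # A) = U" using j \<open>j > 0\<close> by (simp add: last_replicate)
    then show False using last \<open>A \<noteq> []\<close> by simp
  qed
  then have C: "hd C = D" using j by (simp add: step_neq)
  have A_eq: "A = replicate (j - 1) U @ C"
    using j \<open>j > 0\<close> by (cases j) auto
  have w_eq: "U # A @ [D] = replicate j U @ C @ [D]"
    using j by (metis append.assoc append_Cons)
  have "m < j"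
    using long_runs_replicateD[of U m "[]" j "C @ [D]"] long C \<open>C \<noteq> []\<close> \<open>j > 0\<close>
    by (simp add: w_eq)
  show ?thesis
  proof (cases "j = m + 1")
    case False
    have "long_runs U m (C @ [D])"
      using long_runs_split(2)[of U m "replicate j U" "C @ [D]"] long C \<open>C \<noteq> []\<close>
      by (simp add: w_eq)
    then have "long_runs U m C"
      using long_runs_split(1)[of U m C "[D]"] by simp
    \<comment> \<open>The first up-run of \<open>A\<close> has length \<open>j - 1\<close>, still
      greater than \<open>m\<close>.\<close>
    then have "long_runs U m A"
      using False \<open>m < j\<close> unfolding A_eq by (intro long_runs_append long_runs_replicate) auto
    then have "A \<in> avoiding_paths m n"
      using long_down_runs_factor[of A m n "[U]" "[D]"] A long \<open>n \<le> m\<close>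
      by (simp add: avoiding_paths_iff)
    then show ?thesis by (rule elevate_in_prime_lang)
  next
    case True
    \<comment> \<open>The closing \<open>D\<close> is kept, since the first down-run may extend to
      the end of the path.\<close>
    obtain p F where F: "C @ [D] = replicate p D @ F" "F = [] \<or> hd F \<noteq> D"
      by (rule split_replicate)
    have "p > 0" using F C \<open>C \<noteq> []\<close> by (cases p; cases C) auto
    then have "n < p"
      using long_runs_replicateD[of D n "replicate j U" p F] long F \<open>j > 0\<close>
      by (simp add: w_eq last_replicate)
    define G where "G = replicate (p - (n + 1)) D @ F"
    have "replicate p D = replicate (n + 1) D @ replicate (p - (n + 1)) D"
      using \<open>n < p\<close> by (simp flip: replicate_add replicate_Suc)
    then have CG: "C @ [D] = replicate (n + 1) D @ G"
      unfolding F G_def by simp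
    have "G \<in> lang_pow (avoiding_paths m n @@ {[D]}) (m - n)"
    \<comment> \<open>If nothing follows the initial block, the total height forces
      \<open>m = n\<close> and the power is trivial.\<close>
    proof (cases G rule: rev_cases)
      case Nil
      have "height (replicate (m + 1) U @ C @ [D]) = 0"
        using w unfolding avoiding_paths_iff dyck_path_iff w_eq True by simp
      then have "m = n" unfolding CG Nil by simp
      then show ?thesis by (simp add: Nil)
    next
      case (snoc G' s)
      then have "s = D" and C_eq: "C = replicate (n + 1) D @ G'"
        using CG by (simp_all flip: append_assoc del: replicate_Suc)
      \<comment> \<open>Heights are measured within \<open>A\<close>, one level above the axis of
        the whole path; hence the start at \<open>m - n - 1\<close> and the exponent
        \<open>Suc d\<close>.\<close>
      have G': "nonneg_from G' (int m - int (n + 1))" "int m - int (n + 1) + height G' = 0"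
        using A unfolding A_eq C_eq True dyck_path_iff by (simp_all add: algebra_simps del: replicate_Suc)
      then have "n < m" using nonneg_from_start by fastforce
      then obtain d where d: "m - n = Suc d" "int m - int (n + 1) = int d"
        by (metis Suc_diff_Suc Suc_eq_plus1 of_nat_diff Suc_leI)
      let ?X = "replicate (m + 1) U @ replicate (n + 1) D"
      have eq: "U # A @ [D] = ?X @ G' @ [D]"
        unfolding w_eq C_eq True by simp
      have "long_runs U m (G' @ [D])"
        using long(1) unfolding eq append_assoc[symmetric, of "replicate (m + 1) U"]
        by (rule long_runs_split(2)) (simp add: last_replicate del: replicate_Suc)
      then have "long_runs U m G'"
        by (rule long_runs_split(1)) simp
      then have "G' @ [D] \<in> lang_pow (avoiding_paths m n @@ {[D]}) (Suc d)"
        using G' long(2) \<open>n \<le> m\<close> unfolding d(2) eq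
        by (intro descent_decomposition[of _ _ _ _ ?X "[D]"]) (simp_all only: append_assoc)
      then show ?thesis unfolding d(1) snoc \<open>s = D\<close> .
    qed
    then have "U # A @ [D] \<in> lang_pow {[U]} (m + 1) @@ lang_pow {[D]} (n + 1) @@
        lang_pow (avoiding_paths m n @@ {[D]}) (m - n)"
      unfolding w_eq CG True by (intro concI) (simp_all only: lang_pow_single singleton_iff)
    then show ?thesis unfolding prime_lang_def by simp
  qed
qed

text \<open>First return gives one inclusion, closure of the avoiding paths under concatenation the
  other; \<open>UD\<close> accounts for the extra term on the left. The language \<open>L\<close> is
  kept abstract so that it can be \<open>prime_lang\<close> or its reflection.\<close>

lemma avoiding_paths_grammar:
  assumes prime: "\<And>A. dyck_path A \<Longrightarrow> U # A @ [D] \<in> avoiding_paths m n \<Longrightarrow> U # A @ [D] \<in> L"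
    and L: "L \<subseteq> insert [U, D] (avoiding_paths m n)" "[U, D] \<in> L"
  shows "avoiding_paths m n \<union> {[U]} @@ {[D]} @@ avoiding_paths m n =
    {[]} \<union> L @@ avoiding_paths m n"
    (is "?P \<union> _ = _")
proof -
  have "w \<in> {[]} \<union> L @@ ?P" if "w \<in> ?P" for w
  proof (cases "w = []")
    case False
    have w: "dyck_path w" "long_runs U m w" "long_runs D n w"
      using that by (auto simp: avoiding_paths_iff)
    then obtain A B where AB: "w = U # A @ D # B" "dyck_path A" "dyck_path B"
      using False first_return by blast
    let ?V = "U # A @ [D]"
    \<comment> \<open>The cut lies between a \<open>D\<close> and a \<open>U\<close>, so it splits
      no run of either letter.\<close>
    have "?V = [] \<or> B = [] \<or> last ?V \<noteq> s \<or> hd B \<noteq> s" for s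
      using hd_dyck_path[of B] AB by (cases s) auto
    then have "long_runs U m ?V" "long_runs U m B" "long_runs D n ?V" "long_runs D n B"
      using w long_runs_split[of _ _ ?V B] by (simp_all add: AB)
    then have "?V \<in> L" "B \<in> ?P"
      using prime AB dyck_path_elevate by (auto simp: avoiding_paths_iff)
    then have "?V @ B \<in> L @@ ?P" by (rule concI)
    then show ?thesis using AB by simp
  qed simp
  moreover have "{[U]} @@ {[D]} @@ ?P \<subseteq> L @@ ?P"
    using L(2) concI[of "[U, D]" L] by (auto elim!: concE)
  moreover have "L @@ ?P \<subseteq> ?P \<union> {[U]} @@ {[D]} @@ ?P"
  proof
    fix w assume "w \<in> L @@ ?P"
    then obtain u v where uv: "w = u @ v" "u \<in> L" "v \<in> ?P" by (rule concE)
    then show "w \<in> ?P \<union> {[U]} @@ {[D]} @@ ?P"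
      using L(1) avoiding_paths_append concI[of "[U]" "{[U]}" "[D] @ v"] concI[of "[D]" "{[D]}" v]
      by auto
  qed
  ultimately show ?thesis
    using avoiding_paths_Nil[of m n] by blast
qed

text \<open>Reflection turns each factor \<open>P D\<close> into \<open>U P\<close> and moves the
  power to the front, which gives the shape of the equation for \<open>m \<le> n\<close>.\<close>

lemma mirror_prime_lang:
  "mirror ` prime_lang n m = {[U]} @@ avoiding_paths m n @@ {[D]} \<union>
     lang_pow ({[U]} @@ avoiding_paths m n) (n - m) @@ lang_pow {[U]} (m + 1) @@ lang_pow {[D]} (n + 1)"
  unfolding prime_lang_def image_Un mirror_conc mirror_lang_pow mirror_image_avoiding_paths
  by (simp add: conc_assoc del: lang_pow.simps)

theorem proposition12:
  fixes m n :: nat and P :: "step list set"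
  assumes "0 < m" and "0 < n"
    and "P = avoiding_paths m n"
  shows "(m \<ge> n \<longrightarrow>
           P \<union> {[U]} @@ {[D]} @@ P =
           {[]} \<union> {[U]} @@ P @@ {[D]} @@ P \<union>
           lang_pow {[U]} (m + 1) @@ lang_pow {[D]} (n + 1) @@ lang_pow (P @@ {[D]}) (m - n) @@ P) \<and>
         (m \<le> n \<longrightarrow>
           P \<union> {[U]} @@ {[D]} @@ P =
           {[]} \<union> {[U]} @@ P @@ {[D]} @@ P \<union>
           lang_pow ({[U]} @@ P) (n - m) @@ lang_pow {[U]} (m + 1) @@ lang_pow {[D]} (n + 1) @@ P)"
proof (intro conjI impI)
  have UD: "[U, D] \<in> prime_lang k l" for k l
    using elevate_in_prime_lang[OF avoiding_paths_Nil] by simp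
  {
    assume "n \<le> m"
    then have "P \<union> {[U]} @@ {[D]} @@ P = {[]} \<union> prime_lang m n @@ P"
      unfolding assms(3) using \<open>0 < m\<close> UD
      by (intro avoiding_paths_grammar prime_in_prime_lang prime_lang_subset)
    then show "P \<union> {[U]} @@ {[D]} @@ P =
           {[]} \<union> {[U]} @@ P @@ {[D]} @@ P \<union>
           lang_pow {[U]} (m + 1) @@ lang_pow {[D]} (n + 1) @@ lang_pow (P @@ {[D]}) (m - n) @@ P"
      unfolding prime_lang_def assms(3) conc_Un_left conc_assoc by (simp only: Un_assoc)
  next
    assume "m \<le> n"
    \<comment> \<open>Reflecting the whole equation would put the remainder before the prime path.
      So only the prime paths are reflected, and the first-return decomposition is applied
      anew.\<close>
    have "P \<union> {[U]} @@ {[D]} @@ P = {[]} \<union> mirror ` prime_lang n m @@ P"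
      unfolding assms(3)
    proof (rule avoiding_paths_grammar)
      fix A assume "dyck_path A" "U # A @ [D] \<in> avoiding_paths m n"
      then have "U # mirror A @ [D] \<in> prime_lang n m"
        using \<open>m \<le> n\<close> \<open>0 < n\<close> avoiding_paths_mirror[of "U # A @ [D]" n m]
        by (intro prime_in_prime_lang) (simp_all add: dyck_path_mirror)
      then show "U # A @ [D] \<in> mirror ` prime_lang n m"
        by (rule rev_image_eqI) simp
    next
      show "mirror ` prime_lang n m \<subseteq> insert [U, D] (avoiding_paths m n)"
        using prime_lang_subset[OF \<open>m \<le> n\<close>] by (auto simp: avoiding_paths_mirror)
      show "[U, D] \<in> mirror ` prime_lang n m"
        using UD by (rule rev_image_eqI) simp
    qed
    then show "P \<union> {[U]} @@ {[D]} @@ P =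
           {[]} \<union> {[U]} @@ P @@ {[D]} @@ P \<union>
           lang_pow ({[U]} @@ P) (n - m) @@ lang_pow {[U]} (m + 1) @@ lang_pow {[D]} (n + 1) @@ P"
      unfolding mirror_prime_lang assms(3) conc_Un_left conc_assoc by (simp only: Un_assoc)
  }
qed

end
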